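(* Let $p$ be a prime and $q$ a power of $p$. Then $e_{q,p^{2}-p-1}$ divides $p$; that is, the element $b^{-q}a^{-q}(ab)^{q}$ has order dividing $p$ in $M(R(2,q;p^{2}-p-1))$.
   Context: $R(2,q;c)$ denotes the largest $2$-generator group of exponent $q$ and nilpotency class at most $c$, written $R(2,q;c)=F/R$ with $F$ free on $a,b$. The Schur multiplier is $M(G)=(R\cap F')/[F,R]$ (Hopf's formula). $e_{q,c}$ denotes the order of $b^{-q}a^{-q}(ab)^{q}[F,R]$ in $M(R(2,q;c))$. *)

theory Defs
  imports "HOL-Algebra.Algebra"
begin

text \<open>A letter is a pair (g, e): g = False stands for the generator a, g = True for b;
  e = False means the generator itself, e = True its inverse.  Elements of the free group
  are the freely reduced words.\<close>

type_synonym letter = "bool \<times> bool"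

definition cancels :: "letter \<Rightarrow> letter \<Rightarrow> bool" where
  "cancels x y \<longleftrightarrow> fst x = fst y \<and> snd x \<noteq> snd y"

fun push :: "letter \<Rightarrow> letter list \<Rightarrow> letter list" where
  "push x [] = [x]"
| "push x (y # ys) = (if cancels x y then ys else x # y # ys)"

definition reduce :: "letter list \<Rightarrow> letter list" where
  "reduce xs = foldr push xs []"

fun reduced :: "letter list \<Rightarrow> bool" where
  "reduced [] = True"
| "reduced [x] = True"
| "reduced (x # y # ys) = (\<not> cancels x y \<and> reduced (y # ys))"

definition free2 :: "letter list monoid" where
  "free2 = \<lparr> carrier = {w. reduced w}, monoid.mult = (\<lambda>u v. reduce (u @ v)), one = [] \<rparr>"

definition gen_a :: "letter list" where "gen_a = [(False, False)]"
definition gen_b :: "letter list" where "gen_b = [(True, False)]"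

definition comm_subgroup :: "('a, 'b) monoid_scheme \<Rightarrow> 'a set \<Rightarrow> 'a set \<Rightarrow> 'a set" where
  "comm_subgroup G H K = generate G
     {inv\<^bsub>G\<^esub> x \<otimes>\<^bsub>G\<^esub> inv\<^bsub>G\<^esub> y \<otimes>\<^bsub>G\<^esub> x \<otimes>\<^bsub>G\<^esub> y | x y. x \<in> H \<and> y \<in> K}"

text \<open>Lower central series, indexed as usual: gamma_1(G) = G, gamma_(n+1)(G) = [gamma_n(G), G].
  (The index 0 is given the same value as index 1.)\<close>
fun lower_central :: "('a, 'b) monoid_scheme \<Rightarrow> nat \<Rightarrow> 'a set" where
  "lower_central G 0 = carrier G"
| "lower_central G (Suc 0) = carrier G"
| "lower_central G (Suc (Suc n)) = comm_subgroup G (lower_central G (Suc n)) (carrier G)"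

definition power_subgroup :: "('a, 'b) monoid_scheme \<Rightarrow> nat \<Rightarrow> 'a set" where
  "power_subgroup G q = generate G {x [^]\<^bsub>G\<^esub> q | x. x \<in> carrier G}"

text \<open>R(2,q;c) is the largest 2-generator group of exponent q and class at most c, i.e. F/R with
  F = free2 and R = F^q gamma_(c+1)(F) (the verbal subgroup for the laws x^q and
  [x_1,...,x_(c+1)]).\<close>
definition burnside_rel :: "nat \<Rightarrow> nat \<Rightarrow> letter list set" where
  "burnside_rel q c = generate free2 (power_subgroup free2 q \<union> lower_central free2 (Suc c))"

text \<open>Hopf's formula: M(F/R) = (R \<inter> F') / [F,R].\<close>
definition schur_mult :: "nat \<Rightarrow> nat \<Rightarrow> letter list set monoid" where
  "schur_mult q c =
     (free2\<lparr>carrier := burnside_rel q c \<inter> lower_central free2 2\<rparr>)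
       Mod (comm_subgroup free2 (carrier free2) (burnside_rel q c))"

definition wqc :: "nat \<Rightarrow> letter list" where
  "wqc q = inv\<^bsub>free2\<^esub> (gen_b [^]\<^bsub>free2\<^esub> q) \<otimes>\<^bsub>free2\<^esub> inv\<^bsub>free2\<^esub> (gen_a [^]\<^bsub>free2\<^esub> q)
           \<otimes>\<^bsub>free2\<^esub> ((gen_a \<otimes>\<^bsub>free2\<^esub> gen_b) [^]\<^bsub>free2\<^esub> q)"

definition e_qc :: "nat \<Rightarrow> nat \<Rightarrow> nat" where
  "e_qc q c = group.ord (schur_mult q c)
     (comm_subgroup free2 (carrier free2) (burnside_rel q c) #>\<^bsub>free2\<^esub> wqc q)"

end

theory Submission
  imports Defs
begin

text \<open>
  Write \<open>\<gamma>\<^sub>n\<close> for the lower central series of \<open>F\<close> and \<open>N = [F, R]\<close>.  Modulo \<open>N\<close> all \<open>q\<close>-th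
  powers are central and \<open>\<gamma>\<^sub>n\<close> is trivial for \<open>n > p\<^sup>2 - p\<close>.  By Hall--Petrescu, the elements
  \<open>[y\<^sup>e, x] [y, x]\<^sup>-\<^sup>e\<close> and \<open>v\<^sup>-\<^sup>e u\<^sup>-\<^sup>e (u v)\<^sup>e\<close> are products of \<open>(e choose i)\<close>-th powers, \<open>i \<ge> 2\<close>,
  of elements deep in the series.  With \<open>e = q\<close> and \<open>y \<in> \<gamma>\<^sub>n\<^sub>-\<^sub>1\<close>, \<open>n \<ge> p\<close>, the factors with \<open>i \<ge> p\<close> lie
  in \<open>N\<close> and those with \<open>i < p\<close> have exponent divisible by \<open>q\<close>, so downward induction on \<open>n\<close>
  shows that \<open>\<gamma>\<^sub>n\<close> has exponent dividing \<open>q\<close> modulo \<open>N\<close>.  The same argument with \<open>e = p q\<close>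
  shows that \<open>\<gamma>\<^sub>n\<close> has exponent dividing \<open>p q\<close> for \<open>n \<ge> 2\<close>, because \<open>q\<close> divides \<open>(p q choose i)\<close>
  for \<open>0 < i < p\<^sup>2\<close>.  Applied once more to \<open>(a b)\<^sup>p\<^sup>q\<close>, Hall--Petrescu gives
  \<open>b\<^sup>-\<^sup>p\<^sup>q a\<^sup>-\<^sup>p\<^sup>q (a b)\<^sup>p\<^sup>q \<in> N\<close>, which is the \<open>p\<close>-th power of \<open>b\<^sup>-\<^sup>q a\<^sup>-\<^sup>q (a b)\<^sup>q\<close> modulo \<open>N\<close>.

  The Hall--Petrescu formula is obtained in the style of Lazard and Leibman: sequences whose
  \<open>i\<close>-th derivative lies in the \<open>i\<close>-th filtration step are closed under products and commutators.
\<close>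

section \<open>Commutators and the lower central series\<close>

definition commutator :: "('a, 'b) monoid_scheme \<Rightarrow> 'a \<Rightarrow> 'a \<Rightarrow> 'a" where
  "commutator G x y = inv\<^bsub>G\<^esub> x \<otimes>\<^bsub>G\<^esub> inv\<^bsub>G\<^esub> y \<otimes>\<^bsub>G\<^esub> x \<otimes>\<^bsub>G\<^esub> y"

lemma comm_subgroup_eq:
  "comm_subgroup G H K = generate G {commutator G x y | x y. x \<in> H \<and> y \<in> K}"
  by (simp add: comm_subgroup_def commutator_def)

context group
begin

lemma inv_mult_cancel: "\<lbrakk>x \<in> carrier G; y \<in> carrier G\<rbrakk> \<Longrightarrow> inv x \<otimes> (x \<otimes> y) = y"
  by (simp add: m_assoc[symmetric])

lemma mult_inv_cancel: "\<lbrakk>x \<in> carrier G; y \<in> carrier G\<rbrakk> \<Longrightarrow> x \<otimes> (inv x \<otimes> y) = y"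
  by (simp add: m_assoc[symmetric])

lemmas group_word_simps = m_assoc inv_mult_group inv_mult_cancel mult_inv_cancel

lemma subgroup_nat_pow_closed: "\<lbrakk>subgroup H G; x \<in> H\<rbrakk> \<Longrightarrow> x [^] (n::nat) \<in> H"
  by (induction n) (simp_all add: subgroup.one_closed subgroup.m_closed)

lemma commutator_closed [simp]:
  "\<lbrakk>x \<in> carrier G; y \<in> carrier G\<rbrakk> \<Longrightarrow> commutator G x y \<in> carrier G"
  by (simp add: commutator_def)

lemma inv_commutator:
  "\<lbrakk>x \<in> carrier G; y \<in> carrier G\<rbrakk> \<Longrightarrow> inv (commutator G x y) = commutator G y x"
  by (simp add: commutator_def group_word_simps)

lemma commutator_one_left [simp]: "x \<in> carrier G \<Longrightarrow> commutator G \<one> x = \<one>"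
  by (simp add: commutator_def)

text \<open>Conjugation by \<open>g\<close> is a homomorphism, so stability of the generators passes
  to inverses and products. The form \<open>inv g \<otimes> s \<otimes> g\<close> matches the
  convention in \<open>commutator\<close>.\<close>

lemma normal_generateI':
  assumes S: "S \<subseteq> carrier G"
    and conj: "\<And>s g. \<lbrakk>s \<in> S; g \<in> carrier G\<rbrakk> \<Longrightarrow> inv g \<otimes> s \<otimes> g \<in> generate G S"
  shows "generate G S \<lhd> G"
proof -
  have sub: "subgroup (generate G S) G"
    using S by (rule generate_is_subgroup)
  have "inv g \<otimes> x \<otimes> g \<in> generate G S" if "x \<in> generate G S" and g: "g \<in> carrier G" for x g
    using that(1)
  proof (induction rule: generate.induct)
    case one
    then show ?case using g by (simp add: generate.one)
  next
    case (incl h)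
    then show ?case using conj g by blast
  next
    case (inv h)
    have h: "h \<in> carrier G" using inv S by blast
    have "inv (inv g \<otimes> h \<otimes> g) \<in> generate G S"
      using conj[OF inv g] sub by (rule subgroup.m_inv_closed[rotated])
    then show ?case using h g by (simp add: group_word_simps)
  next
    case (eng h1 h2)
    have h: "h1 \<in> carrier G" "h2 \<in> carrier G"
      using eng S generate_in_carrier by blast+
    have "(inv g \<otimes> h1 \<otimes> g) \<otimes> (inv g \<otimes> h2 \<otimes> g) \<in> generate G S"
      using eng sub by (simp add: subgroup.m_closed)
    then show ?case using h g by (simp add: group_word_simps)
  qed
  from this[of _ "inv _"] show ?thesis
    by (intro normal_invI sub) (metis inv_closed inv_inv)
qed

lemma normal_conj_closed:
  assumes "N \<lhd> G" "x \<in> N" "g \<in> carrier G"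
  shows "inv g \<otimes> x \<otimes> g \<in> N"
  using normal.inv_op_closed1[OF assms(1) assms(3,2)] .

lemma normal_commutator_left:
  assumes N: "N \<lhd> G" and x: "x \<in> N" and g: "g \<in> carrier G"
  shows "commutator G x g \<in> N"
proof -
  interpret N: subgroup N G using N by (rule normal_imp_subgroup)
  have "inv x \<otimes> (inv g \<otimes> x \<otimes> g) \<in> N"
    using normal_conj_closed[OF N x g] x by simp
  moreover have "x \<in> carrier G" using x by simp
  ultimately show ?thesis
    using g by (simp add: commutator_def group_word_simps)
qed

lemma normal_commutator_right:
  assumes N: "N \<lhd> G" and x: "x \<in> N" and g: "g \<in> carrier G"
  shows "commutator G g x \<in> N"
proof -
  interpret N: subgroup N G using N by (rule normal_imp_subgroup)
  have "x \<in> carrier G" using x by simp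
  then show ?thesis
    using N.m_inv_closed[OF normal_commutator_left[OF N x g]] g by (simp add: inv_commutator)
qed

text \<open>Since \<open>[x, y]^g = [x, g]^-1 [x, y g]\<close>, conjugates of generators stay inside
  for any subset \<open>H\<close>.\<close>

lemma comm_subgroup_carrier_right_normal:
  assumes "H \<subseteq> carrier G"
  shows "comm_subgroup G H (carrier G) \<lhd> G"
  unfolding comm_subgroup_eq
proof (rule normal_generateI', goal_cases)
  case 1
  then show ?case using assms by auto
next
  case (2 s g)
  let ?N = "generate G {commutator G x y | x y. x \<in> H \<and> y \<in> carrier G}"
  have sub: "subgroup ?N G" using assms by (intro generate_is_subgroup) auto
  from 2 obtain x y where xy: "x \<in> H" "y \<in> carrier G" and s: "s = commutator G x y" by auto
  have gens: "commutator G x g \<in> ?N" "commutator G x (y \<otimes> g) \<in> ?N"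
    using xy 2 by (auto intro!: generate.incl)
  have "inv (commutator G x g) \<otimes> commutator G x (y \<otimes> g) \<in> ?N"
    using gens sub by (simp add: subgroup.m_closed subgroup.m_inv_closed)
  moreover have "x \<in> carrier G" using xy assms by blast
  ultimately show ?case
    using xy 2 by (simp add: s commutator_def group_word_simps)
qed

text \<open>Hopf's formula puts the whole group on the left, the lower central series on the right.
  The two generating sets consist of mutually inverse elements.\<close>

lemma comm_subgroup_carrier_commute:
  assumes "H \<subseteq> carrier G"
  shows "comm_subgroup G (carrier G) H = comm_subgroup G H (carrier G)"
proof -
  have *: "generate G {commutator G x y | x y. x \<in> A \<and> y \<in> B}
      \<subseteq> generate G {commutator G x y | x y. x \<in> B \<and> y \<in> A}"
    (is "generate G ?S \<subseteq> generate G ?T")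
    if A: "A \<subseteq> carrier G" and B: "B \<subseteq> carrier G" for A B
  proof (rule generate_subgroup_incl)
    show sub: "subgroup (generate G ?T) G"
      using A B by (intro generate_is_subgroup) (auto simp: subset_iff)
    show "?S \<subseteq> generate G ?T"
    proof
      fix s assume "s \<in> ?S"
      then obtain x y where xy: "x \<in> A" "y \<in> B" and s: "s = commutator G x y" by auto
      then have "commutator G y x \<in> generate G ?T"
        by (auto intro: generate.incl)
      from subgroup.m_inv_closed[OF sub this] show "s \<in> generate G ?T"
        using xy A B s by (simp add: inv_commutator subset_iff)
    qed
  qed
  show ?thesis
    unfolding comm_subgroup_eq using *[of H "carrier G"] *[of "carrier G" H] assms by blast
qed



section \<open>The lower central series as a descending central filtration\<close>

lemma lower_central_subset_carrier: "lower_central G n \<subseteq> carrier G"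
proof -
  have "lower_central G n \<subseteq> carrier G \<and> lower_central G (Suc n) \<subseteq> carrier G"
  proof (induction n)
    case (Suc n)
    then have "comm_subgroup G (lower_central G (Suc n)) (carrier G) \<lhd> G"
      by (intro comm_subgroup_carrier_right_normal) blast
    then have "lower_central G (Suc (Suc n)) \<subseteq> carrier G"
      using normal_imp_subgroup subgroup.subset by fastforce
    then show ?case using Suc by simp
  qed simp
  then show ?thesis by simp
qed

lemma normal_carrier: "carrier G \<lhd> G"
  by (intro normal_invI subgroup_self) auto

lemma lower_central_normal: "lower_central G n \<lhd> G"
  by (cases "(G, n)" rule: lower_central.cases)
    (auto simp: normal_carrier comm_subgroup_carrier_right_normal lower_central_subset_carrier)

lemma lower_central_subgroup: "subgroup (lower_central G n) G"
  using lower_central_normal by (rule normal_imp_subgroup)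

lemma lower_central_commutator_Suc:
  assumes x: "x \<in> lower_central G n" and y: "y \<in> carrier G"
  shows "commutator G x y \<in> lower_central G (Suc n)"
proof (cases n)
  case 0
  then show ?thesis using assms by simp
next
  case (Suc m)
  then show ?thesis using assms by (auto simp: comm_subgroup_eq intro!: generate.incl)
qed

lemma lower_central_Suc_subset: "lower_central G (Suc n) \<subseteq> lower_central G n"
proof (cases n)
  case (Suc m)
  show ?thesis
    unfolding Suc lower_central.simps(3) comm_subgroup_eq
    by (rule generate_subgroup_incl[OF _ lower_central_subgroup])
      (auto simp: normal_commutator_left lower_central_normal)
qed simp

lemma lower_central_antimono: "m \<le> n \<Longrightarrow> lower_central G n \<subseteq> lower_central G m"
  by (induction n rule: dec_induct) (use lower_central_Suc_subset in blast)+

text \<open>The Hall--Witt identity, solved for the factor that contains \<^term>\<open>commutator G y z\<close>.\<close>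

lemma hall_witt:
  assumes "x \<in> carrier G" "y \<in> carrier G" "z \<in> carrier G"
  shows "commutator G x (commutator G y z) =
    inv z \<otimes> ((inv x \<otimes> commutator G (commutator G (inv z) (inv x)) y \<otimes> x) \<otimes>
      (inv y \<otimes> commutator G (commutator G x (inv y)) (inv z) \<otimes> y)) \<otimes> z"
  using assms by (simp add: commutator_def group_word_simps)

text \<open>For a generator \<open>[u, z]\<close> of the next term, Hall-Witt turns
  \<open>[x, [u, z]]\<close> into conjugates of commutators in which \<open>u\<close> has depth only
  \<open>j\<close>. The induction hypothesis then applies at depths \<open>i + 1\<close> and
  \<open>i\<close>, which is why \<open>i\<close> is kept arbitrary.\<close>

lemma lower_central_commutator:
  assumes "x \<in> lower_central G i" "y \<in> lower_central G j"
  shows "commutator G x y \<in> lower_central G (i + j)"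
  using assms
proof (induction j arbitrary: i x y)
  \<comment> \<open>Index 0 is the whole group, so this is normality of the \<open>i\<close>-th
    term.\<close>
  case 0
  then show ?case by (simp add: normal_commutator_left lower_central_normal)
next
  case (Suc j)
  show ?case
  proof (cases j)
    case 0
    then show ?thesis using Suc.prems by (simp add: lower_central_commutator_Suc)
  next
    case (Suc m)
    let ?M = "lower_central G (i + Suc j)"
    note normal = lower_central_normal[of "i + Suc j"]
    interpret M: subgroup ?M G by (rule lower_central_subgroup)
    interpret X: subgroup "lower_central G i" G by (rule lower_central_subgroup)
    interpret J: subgroup "lower_central G j" G by (rule lower_central_subgroup)
    note conj = normal_conj_closed[OF normal]
    have x: "x \<in> carrier G" "x \<in> lower_central G i" using Suc.prems by auto
    let ?S = "{commutator G u z | u z. u \<in> lower_central G j \<and> z \<in> carrier G}"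
    have S: "?S \<subseteq> carrier G" by auto
    have "y \<in> generate G ?S"
      using Suc.prems(2) by (simp add: Suc comm_subgroup_eq)
    then show ?thesis
    proof (induction rule: generate.induct)
      case one
      then show ?case using x M.one_closed by (simp add: commutator_def)
    next
      have gen: "commutator G x h \<in> ?M" if "h \<in> ?S" for h
      proof -
        from that obtain u z where h: "h = commutator G u z"
          and u: "u \<in> lower_central G j" "u \<in> carrier G" and z: "z \<in> carrier G" by auto
        have "commutator G (inv x) (inv z) \<in> lower_central G (Suc i)"
          using x z by (intro lower_central_commutator_Suc) auto
        from subgroup.m_inv_closed[OF lower_central_subgroup this]
        have "commutator G (inv z) (inv x) \<in> lower_central G (Suc i)"
          using x z by (simp add: inv_commutator)
        from Suc.IH[OF this u(1)]
        have 1: "commutator G (commutator G (inv z) (inv x)) u \<in> ?M" by simp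
        have "commutator G (commutator G x (inv u)) (inv z) \<in> lower_central G (Suc (i + j))"
          using Suc.IH[of x i "inv u"] x u z by (intro lower_central_commutator_Suc) auto
        then have 2: "commutator G (commutator G x (inv u)) (inv z) \<in> ?M" by simp
        show ?thesis
          unfolding h hall_witt[OF x(1) u(2) z]
          by (intro conj M.m_closed 1 2 x u z)
      qed
      {
        case (incl h)
        then show ?case by (rule gen)
      next
        case (inv h)
        have h: "h \<in> carrier G" using inv S by blast
        \<comment> \<open>\<open>[x, h^-1]\<close> is the conjugate of \<open>[x, h]^-1\<close> by
          \<open>h^-1\<close>.\<close>
        have "inv (inv h) \<otimes> inv (commutator G x h) \<otimes> inv h \<in> ?M"
          using h M.m_inv_closed[OF gen[OF inv]] by (intro conj) simp_all
        then show ?case using x h by (simp add: commutator_def group_word_simps)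
      }
    next
      case (eng h1 h2)
      have h: "h1 \<in> carrier G" "h2 \<in> carrier G"
        using eng S generate_in_carrier by blast+
      \<comment> \<open>\<open>[x, h1 h2] = [x, h2] [x, h1]^h2\<close>.\<close>
      have "commutator G x h2 \<otimes> (inv h2 \<otimes> commutator G x h1 \<otimes> h2) \<in> ?M"
        using h eng.IH by (intro M.m_closed[OF _ conj])
      then show ?case using x h by (simp add: commutator_def group_word_simps)
    qed
  qed
qed

end


section \<open>Polynomial sequences\<close>

text \<open>Later instantiated with the lower central series, whose terms of index 0 and 1 coincide.
  Starting at 0 lets power sequences such as \<open>y [^] n\<close> begin at depth 0 and gain
  \<open>d\<close> with each derivative.\<close>

locale filtered_group = group G for G (structure) +
  fixes \<Gamma> :: "nat \<Rightarrow> 'a set"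
  assumes subgroup_filtration: "subgroup (\<Gamma> i) G"
    and filtration_Suc: "\<Gamma> (Suc i) \<subseteq> \<Gamma> i"
    and filtration_commutator: "\<lbrakk>x \<in> \<Gamma> i; y \<in> \<Gamma> j\<rbrakk> \<Longrightarrow> commutator G x y \<in> \<Gamma> (i + j)"
begin

lemma filtration_antimono: "m \<le> n \<Longrightarrow> \<Gamma> n \<subseteq> \<Gamma> m"
  by (induction n rule: dec_induct) (use filtration_Suc in blast)+

lemma filtration_closed: "x \<in> \<Gamma> i \<Longrightarrow> x \<in> carrier G"
  using subgroup.mem_carrier[OF subgroup_filtration] .

definition deriv :: "(nat \<Rightarrow> 'a) \<Rightarrow> nat \<Rightarrow> 'a" where
  "deriv f n = inv (f n) \<otimes> f (Suc n)"

text \<open>The first \<^term>\<open>t\<close> iterated derivatives of \<^term>\<open>f\<close> take values in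
  \<open>\<Gamma> j, \<Gamma> (j + d), \<Gamma> (j + 2 d), \<dots>\<close>.  Truncating at \<^term>\<open>t\<close> is what lets closure under
  products and commutators be proved by a plain induction.\<close>

primrec poly_trunc :: "nat \<Rightarrow> nat \<Rightarrow> nat \<Rightarrow> (nat \<Rightarrow> 'a) \<Rightarrow> bool" where
  "poly_trunc d 0 j f \<longleftrightarrow> range f \<subseteq> \<Gamma> j"
| "poly_trunc d (Suc t) j f \<longleftrightarrow> range f \<subseteq> \<Gamma> j \<and> poly_trunc d t (j + d) (deriv f)"

lemma poly_trunc_range: "poly_trunc d t j f \<Longrightarrow> f n \<in> \<Gamma> j"
  by (cases t) auto

lemma poly_trunc_closed: "poly_trunc d t j f \<Longrightarrow> f n \<in> carrier G"
  using poly_trunc_range filtration_closed by blast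

lemma poly_trunc_mono: "\<lbrakk>poly_trunc d t j f; i \<le> j\<rbrakk> \<Longrightarrow> poly_trunc d t i f"
proof (induction t arbitrary: i j f)
  case 0
  then show ?case using filtration_antimono[of i j] by auto
next
  case (Suc t)
  then show ?case using filtration_antimono[of i j] by (auto intro: Suc.IH[of "j + d"])
qed

lemma poly_trunc_pred: "poly_trunc d (Suc t) j f \<Longrightarrow> poly_trunc d t j f"
proof (induction t arbitrary: j f)
  case (Suc t)
  then have "range f \<subseteq> \<Gamma> j" "poly_trunc d (Suc t) (j + d) (deriv f)"
    by simp_all
  with Suc.IH show ?case by simp
qed simp

lemma poly_trunc_shift: "poly_trunc d t j f \<Longrightarrow> poly_trunc d t j (\<lambda>n. f (Suc n))"
proof (induction t arbitrary: j f)
  case (Suc t)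
  then have "poly_trunc d t (j + d) (\<lambda>n. deriv f (Suc n))" by auto
  moreover have "(\<lambda>n. deriv f (Suc n)) = deriv (\<lambda>n. f (Suc n))"
    by (simp add: deriv_def fun_eq_iff)
  ultimately show ?case using Suc by auto
qed auto

lemma deriv_const: "g \<in> carrier G \<Longrightarrow> deriv (\<lambda>n. g) = (\<lambda>n. \<one>)"
  by (simp add: deriv_def fun_eq_iff)

lemma deriv_mult:
  assumes "range f \<subseteq> carrier G" "range g \<subseteq> carrier G"
  shows "deriv (\<lambda>n. f n \<otimes> g n) =
    (\<lambda>n. deriv f n \<otimes> commutator G (deriv f n) (g n) \<otimes> deriv g n)"
proof
  fix n
  have "f n \<in> carrier G" "f (Suc n) \<in> carrier G" "g n \<in> carrier G" "g (Suc n) \<in> carrier G"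
    using assms by auto
  then show "deriv (\<lambda>n. f n \<otimes> g n) n =
      deriv f n \<otimes> commutator G (deriv f n) (g n) \<otimes> deriv g n"
    by (simp add: deriv_def commutator_def group_word_simps)
qed

text \<open>Expand \<open>[f df, g dg]\<close> by the product rules and move \<open>[f, g]\<close>
  to the front, where it cancels. Every remaining factor contains \<open>deriv f n\<close> or
  \<open>deriv g n\<close> and so lies \<open>d\<close> deeper.\<close>

lemma deriv_commutator:
  assumes "range f \<subseteq> carrier G" "range g \<subseteq> carrier G"
  shows "deriv (\<lambda>n. commutator G (f n) (g n)) =
    (\<lambda>n. commutator G (f (Suc n)) (deriv g n) \<otimes>
      commutator G (commutator G (f (Suc n)) (deriv g n)) (commutator G (f n) (g n)) \<otimes>
      commutator G (commutator G (f n) (g n)) (deriv f n) \<otimes>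
      commutator G (deriv f n) (g n) \<otimes>
      commutator G (commutator G (f (Suc n)) (g n)) (deriv g n))"
    (is "_ = ?R")
proof
  fix n
  have "f n \<in> carrier G" "f (Suc n) \<in> carrier G" "g n \<in> carrier G" "g (Suc n) \<in> carrier G"
    using assms by auto
  then show "deriv (\<lambda>n. commutator G (f n) (g n)) n = ?R n"
    by (simp add: deriv_def commutator_def group_word_simps)
qed

text \<open>The two claims need each other: the derivative of a product contains a commutator, and
  that of a commutator is a product of commutators. All of these are controlled one truncation level
  lower.\<close>

lemma poly_trunc_mult_commutator:
  "(\<forall>j f g. poly_trunc d t j f \<longrightarrow> poly_trunc d t j g \<longrightarrow> poly_trunc d t j (\<lambda>n. f n \<otimes> g n)) \<and>
   (\<forall>i j f g. poly_trunc d t i f \<longrightarrow> poly_trunc d t j g \<longrightarrow>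
      poly_trunc d t (i + j) (\<lambda>n. commutator G (f n) (g n)))"
proof (induction t)
  case 0
  show ?case
    by (auto intro!: subgroup.m_closed[OF subgroup_filtration] filtration_commutator)
next
  case (Suc t)
  then have mult: "\<lbrakk>poly_trunc d t j f; poly_trunc d t j g\<rbrakk> \<Longrightarrow>
      poly_trunc d t j (\<lambda>n. f n \<otimes> g n)"
    and comm: "\<lbrakk>poly_trunc d t i f; poly_trunc d t j g\<rbrakk> \<Longrightarrow>
      poly_trunc d t (i + j) (\<lambda>n. commutator G (f n) (g n))" for i j f g
    by blast+
  show ?case
  proof (intro conjI allI impI)
    fix j f g
    assume F: "poly_trunc d (Suc t) j f" and H: "poly_trunc d (Suc t) j g"
    have g: "poly_trunc d t j g"
      using H by (rule poly_trunc_pred)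
    have df: "poly_trunc d t (j + d) (deriv f)" and dg: "poly_trunc d t (j + d) (deriv g)"
      using F H by auto
    have "poly_trunc d t (j + d) (\<lambda>n. commutator G (deriv f n) (g n))"
      using comm[OF df g] by (rule poly_trunc_mono) simp
    then have "poly_trunc d t (j + d)
        (\<lambda>n. deriv f n \<otimes> commutator G (deriv f n) (g n) \<otimes> deriv g n)"
      by (intro mult df dg)
    moreover have "range f \<subseteq> carrier G" "range g \<subseteq> carrier G"
      using F H poly_trunc_closed by blast+
    ultimately show "poly_trunc d (Suc t) j (\<lambda>n. f n \<otimes> g n)"
      using F H by (auto simp: deriv_mult intro!: subgroup.m_closed[OF subgroup_filtration])
  next
    fix i j f g
    assume F: "poly_trunc d (Suc t) i f" and H: "poly_trunc d (Suc t) j g"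
    have f: "poly_trunc d t i f" and g: "poly_trunc d t j g"
      using F H by (auto dest: poly_trunc_pred simp del: poly_trunc.simps)
    have df: "poly_trunc d t (i + d) (deriv f)" and dg: "poly_trunc d t (j + d) (deriv g)"
      using F H by auto
    note f' = poly_trunc_shift[OF f]
    have 1: "poly_trunc d t (i + j + d) (\<lambda>n. commutator G (f (Suc n)) (deriv g n))"
      using comm[OF f' dg] by (rule poly_trunc_mono) simp
    have 2: "poly_trunc d t (i + j + d) (\<lambda>n. commutator G
        (commutator G (f (Suc n)) (deriv g n)) (commutator G (f n) (g n)))"
      using comm[OF 1 comm[OF f g]] by (rule poly_trunc_mono) simp
    have 3: "poly_trunc d t (i + j + d) (\<lambda>n. commutator G (commutator G (f n) (g n)) (deriv f n))"
      using comm[OF comm[OF f g] df] by (rule poly_trunc_mono) simp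
    have 4: "poly_trunc d t (i + j + d) (\<lambda>n. commutator G (deriv f n) (g n))"
      using comm[OF df g] by (rule poly_trunc_mono) simp
    have 5: "poly_trunc d t (i + j + d)
        (\<lambda>n. commutator G (commutator G (f (Suc n)) (g n)) (deriv g n))"
      using comm[OF comm[OF f' g] dg] by (rule poly_trunc_mono) simp
    have range: "range f \<subseteq> carrier G" "range g \<subseteq> carrier G"
      using f g poly_trunc_closed by blast+
    have "poly_trunc d t (i + j + d) (deriv (\<lambda>n. commutator G (f n) (g n)))"
      unfolding deriv_commutator[OF range] by (intro mult 1 2 3 4 5)
    moreover have "range (\<lambda>n. commutator G (f n) (g n)) \<subseteq> \<Gamma> (i + j)"
      using F H by (auto intro!: filtration_commutator)
    ultimately show "poly_trunc d (Suc t) (i + j) (\<lambda>n. commutator G (f n) (g n))"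
      by simp
  qed
qed

section \<open>Untruncated polynomial sequences and the Hall-Petrescu formula\<close>

definition poly :: "nat \<Rightarrow> nat \<Rightarrow> (nat \<Rightarrow> 'a) \<Rightarrow> bool" where
  "poly d j f \<longleftrightarrow> (\<forall>t. poly_trunc d t j f)"

lemma poly_iff_deriv: "poly d j f \<longleftrightarrow> range f \<subseteq> \<Gamma> j \<and> poly d (j + d) (deriv f)"
proof
  assume "poly d j f"
  then have "poly_trunc d (Suc t) j f" for t by (auto simp only: poly_def)
  then show "range f \<subseteq> \<Gamma> j \<and> poly d (j + d) (deriv f)" by (simp add: poly_def)
next
  assume *: "range f \<subseteq> \<Gamma> j \<and> poly d (j + d) (deriv f)"
  have "poly_trunc d t j f" for t
    using * by (cases t) (simp_all add: poly_def)
  then show "poly d j f" by (simp add: poly_def)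
qed

lemma poly_range: "poly d j f \<Longrightarrow> f n \<in> \<Gamma> j"
  using poly_def poly_trunc_range by blast

lemma poly_mult: "\<lbrakk>poly d j f; poly d j g\<rbrakk> \<Longrightarrow> poly d j (\<lambda>n. f n \<otimes> g n)"
  using poly_trunc_mult_commutator unfolding poly_def by blast

lemma poly_commutator:
  "\<lbrakk>poly d i f; poly d j g\<rbrakk> \<Longrightarrow> poly d (i + j) (\<lambda>n. commutator G (f n) (g n))"
  using poly_trunc_mult_commutator unfolding poly_def by blast

lemma poly_one: "poly d j (\<lambda>n. \<one>)"
proof -
  have "poly_trunc d t j (\<lambda>n. \<one>)" for t
    by (induction t arbitrary: j) (auto simp: deriv_const subgroup.one_closed[OF subgroup_filtration])
  then show ?thesis by (simp add: poly_def)
qed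

lemma poly_const: "g \<in> \<Gamma> j \<Longrightarrow> poly d j (\<lambda>n. g)"
  using poly_one[of d "j + d"] filtration_closed
  by (auto simp: poly_iff_deriv[of d j "\<lambda>n. g"] deriv_const)

text \<open>By Pascal's rule, taking the derivative replaces \<open>n choose Suc k\<close> by
  \<open>n choose k\<close>.\<close>

lemma poly_pow_choose: "g \<in> \<Gamma> (j + d * k) \<Longrightarrow> poly d j (\<lambda>n. g [^] (n choose k))"
proof (induction k arbitrary: j)
  case 0
  then show ?case using poly_const filtration_closed by simp
next
  case (Suc k)
  have g: "g \<in> carrier G" using Suc.prems filtration_closed by blast
  have "g \<in> \<Gamma> j" using Suc.prems filtration_antimono[of j "j + d * Suc k"] by auto
  then have "range (\<lambda>n. g [^] (n choose Suc k)) \<subseteq> \<Gamma> j"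
    using subgroup_filtration by (auto simp: subgroup_nat_pow_closed)
  moreover have "deriv (\<lambda>n. g [^] (n choose Suc k)) = (\<lambda>n. g [^] (n choose k))"
  proof
    fix n
    have "g [^] (Suc n choose Suc k) = g [^] (n choose Suc k) \<otimes> g [^] (n choose k)"
      using g by (simp add: nat_pow_mult add.commute)
    then show "deriv (\<lambda>n. g [^] (n choose Suc k)) n = g [^] (n choose k)"
      using g by (simp add: deriv_def inv_mult_cancel)
  qed
  moreover have "poly d (j + d) (\<lambda>n. g [^] (n choose k))"
    using Suc.prems by (intro Suc.IH) (simp add: add.assoc)
  ultimately show ?case by (subst poly_iff_deriv) simp
qed

lemma poly_pow: "g \<in> \<Gamma> (j + d) \<Longrightarrow> poly d j (\<lambda>n. g [^] n)"
  using poly_pow_choose[of g j d 1] by simp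

text \<open>If the values before \<open>k\<close> are trivial, \<open>f k\<close> equals the
  \<open>k\<close>-th derivative at 0, which has depth \<open>j + d * k\<close>.\<close>

lemma poly_vanishing:
  assumes "poly d j f" "\<And>m. m < k \<Longrightarrow> f m = \<one>"
  shows "f k \<in> \<Gamma> (j + d * k)"
  using assms
proof (induction k arbitrary: j f)
  case 0
  then show ?case by (simp add: poly_range)
next
  case (Suc k)
  have "f (Suc k) \<in> carrier G" using Suc.prems poly_range filtration_closed by blast
  then have "deriv f k = f (Suc k)" using Suc.prems by (simp add: deriv_def)
  moreover have "deriv f k \<in> \<Gamma> (j + d + d * k)"
  proof (rule Suc.IH)
    show "poly d (j + d) (deriv f)" using Suc.prems poly_iff_deriv by blast
    show "deriv f m = \<one>" if "m < k" for m
      using Suc.prems(2)[of m] Suc.prems(2)[of "Suc m"] that by (simp add: deriv_def)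
  qed
  ultimately show ?case by (simp add: add.assoc)
qed

text \<open>A form of the Hall--Petrescu formula: \<open>f n\<close> is a product of powers \<open>g\<^sub>i [^] (n choose i)\<close>
  with \<open>g\<^sub>i \<in> \<Gamma> (j + d * i)\<close>, where only the indices \<open>k \<le> i \<le> n\<close> occur.\<close>

lemma poly_value_mem:
  assumes "poly d j f" "\<And>m. m < k \<Longrightarrow> f m = \<one>"
    and S: "subgroup S G"
    and pow: "\<And>i g. \<lbrakk>k \<le> i; i \<le> n; g \<in> \<Gamma> (j + d * i)\<rbrakk> \<Longrightarrow> g [^] (n choose i) \<in> S"
  shows "f n \<in> S"
  using assms(1,2,4)
proof (induction "Suc n - k" arbitrary: k f)
  case 0
  then show ?case using subgroup.one_closed[OF S] by simp
next
  case (Suc r)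
  let ?g = "f k"
  \<comment> \<open>Dividing by this power makes the value at \<open>k\<close> trivial and leaves
    the earlier ones trivial, because \<open>m choose k\<close> is 0 for
    \<open>m < k\<close>.\<close>
  define h where "h = (\<lambda>m. inv ?g [^] (m choose k) \<otimes> f m)"
  have f: "f m \<in> carrier G" for m using Suc.prems poly_range filtration_closed by blast
  have g: "?g \<in> \<Gamma> (j + d * k)" using Suc.prems(1,2) by (rule poly_vanishing)
  then have "inv ?g \<in> \<Gamma> (j + d * k)" using subgroup.m_inv_closed[OF subgroup_filtration] by blast
  then have "poly d j h"
    unfolding h_def by (intro poly_mult poly_pow_choose Suc.prems)
  moreover have "h m = \<one>" if "m < Suc k" for m
    using that Suc.prems(2) f by (cases "m = k") (auto simp: h_def binomial_eq_0)
  ultimately have "h n \<in> S"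
    using Suc.hyps(2) Suc.prems(3) by (intro Suc.hyps(1)[of "Suc k" h]) simp_all
  moreover have "?g [^] (n choose k) \<in> S"
    using Suc.hyps(2) Suc.prems(3) g by simp
  moreover have "f n = ?g [^] (n choose k) \<otimes> h n"
    using f by (simp add: h_def nat_pow_inv mult_inv_cancel)
  ultimately show ?case using subgroup.m_closed[OF S] by simp
qed

text \<open>The word is a polynomial sequence in the exponent. Its values at 0 and 1 are trivial, so
  only indices from 2 on contribute.\<close>

lemma power_mult_mem:
  assumes x: "x \<in> \<Gamma> d" and y: "y \<in> \<Gamma> d" and S: "subgroup S G"
    and pow: "\<And>i g. \<lbrakk>2 \<le> i; i \<le> n; g \<in> \<Gamma> (d * i)\<rbrakk> \<Longrightarrow> g [^] (n choose i) \<in> S"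
  shows "inv (y [^] n) \<otimes> inv (x [^] n) \<otimes> (x \<otimes> y) [^] n \<in> S"
proof -
  interpret D: subgroup "\<Gamma> d" G by (rule subgroup_filtration)
  have xy: "x \<in> carrier G" "y \<in> carrier G" using x y by simp_all
  define f where "f m = inv y [^] m \<otimes> inv x [^] m \<otimes> (x \<otimes> y) [^] m" for m :: nat
  have "poly d 0 f"
    unfolding f_def using x y by (intro poly_mult poly_pow) simp_all
  moreover have "f m = \<one>" if "m < 2" for m
    using that xy by (auto simp: f_def less_2_cases_iff group_word_simps)
  ultimately have "f n \<in> S"
    using S pow by (rule poly_value_mem) simp_all
  then show ?thesis using xy by (simp add: f_def nat_pow_inv)
qed

text \<open>The constant \<open>x\<close> contributes depth \<open>j\<close> and each derivative of
  \<open>y [^] m\<close> contributes \<open>d\<close>. Correcting by \<open>[y, x]^-m\<close> kills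
  the value at 1.\<close>

lemma commutator_power_mem:
  assumes y: "y \<in> \<Gamma> d" and x: "x \<in> \<Gamma> j" and S: "subgroup S G"
    and pow: "\<And>i g. \<lbrakk>2 \<le> i; i \<le> n; g \<in> \<Gamma> (j + d * i)\<rbrakk> \<Longrightarrow> g [^] (n choose i) \<in> S"
  shows "commutator G (y [^] n) x \<otimes> inv (commutator G y x [^] n) \<in> S"
proof -
  have xy: "x \<in> carrier G" "y \<in> carrier G" using x y filtration_closed by blast+
  have c: "inv (commutator G y x) \<in> \<Gamma> (j + d)"
    using filtration_commutator[OF y x] subgroup.m_inv_closed[OF subgroup_filtration]
    by (simp add: add.commute)
  define f where "f m = commutator G (y [^] m) x \<otimes> inv (commutator G y x) [^] m" for m :: nat
  have "poly d 0 (\<lambda>m. y [^] m)" using y by (intro poly_pow) simp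
  from poly_commutator[OF this poly_const[OF x]]
  have "poly d j f"
    unfolding f_def using c by (intro poly_mult poly_pow) simp_all
  moreover have "f m = \<one>" if "m < 2" for m
    using that xy by (auto simp: f_def less_2_cases_iff)
  ultimately have "f n \<in> S"
    using S pow by (rule poly_value_mem) simp_all
  then show ?thesis using xy by (simp add: f_def nat_pow_inv)
qed

end


section \<open>Powers modulo a subgroup that makes \<open>q\<close>-th powers central\<close>

lemma prime_power_dvd_choose:
  fixes p :: nat
  assumes p: "Factorial_Ring.prime p" and i: "0 < i" "i < p"
  shows "p ^ k dvd (p ^ k choose i)"
proof -
  have "coprime (p ^ k) i"
    using p i by (simp add: nat_dvd_not_less prime_imp_coprime)
  moreover have "p ^ k dvd i * (p ^ k choose i)"
    using i by (simp add: times_binomial_minus1_eq)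
  ultimately show ?thesis by (simp add: coprime_dvd_mult_right_iff)
qed

text \<open>In \<open>i * (n choose i) = n * (n - 1 choose i - 1)\<close> an index
  \<open>0 < i < p\<^sup>2\<close> absorbs at most one factor \<open>p\<close>.\<close>

lemma prime_power_dvd_choose_Suc:
  fixes p :: nat
  assumes p: "Factorial_Ring.prime p" and i: "0 < i" "i < p\<^sup>2"
  shows "p ^ k dvd (p ^ Suc k choose i)"
proof -
  have *: "p ^ Suc k dvd i * (p ^ Suc k choose i)"
    using i by (simp add: times_binomial_minus1_eq del: power_Suc)
  show ?thesis
  proof (cases "p dvd i")
    case False
    then have "coprime (p ^ Suc k) i" using p by (simp add: prime_imp_coprime)
    then have "p ^ Suc k dvd (p ^ Suc k choose i)"
      using * by (simp add: coprime_dvd_mult_right_iff)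
    then show ?thesis by (meson dvd_trans le_imp_power_dvd le_SucI order_refl)
  next
    case True
    then obtain u where u: "i = p * u" by blast
    have "0 < u" "u < p" using i u by (auto simp: power2_eq_square)
    then have "coprime (p ^ k) u"
      using p by (simp add: nat_dvd_not_less prime_imp_coprime)
    moreover have "p * p ^ k dvd p * (u * (p ^ Suc k choose i))"
      using * by (simp add: u mult.assoc)
    then have "p ^ k dvd u * (p ^ Suc k choose i)"
      using p by (metis dvd_mult_cancel1 dvd_times_left_cancel_iff not_prime_0)
    ultimately show ?thesis by (simp add: coprime_dvd_mult_right_iff)
  qed
qed

context group
begin

lemma filtered_lower_central: "filtered_group G (lower_central G)"
  by (intro filtered_group.intro filtered_group_axioms.intro is_group lower_central_subgroup
      lower_central_Suc_subset lower_central_commutator)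

lemma pow_mem_of_dvd:
  assumes S: "subgroup S G" and x: "x \<in> carrier G" "x [^] (a::nat) \<in> S" and dvd: "a dvd b"
  shows "x [^] b \<in> S"
proof -
  obtain m where "b = a * m" using dvd by blast
  then show ?thesis
    using subgroup_nat_pow_closed[OF S x(2), of m] x(1) by (simp add: nat_pow_pow)
qed

text \<open>Common induction step for the exponents \<open>q\<close> and \<open>p * q\<close>.
  Centrality handles \<open>[y^e, x]\<close> for a generator \<open>[y, x]\<close>; the binomial
  corrections, for generators and for products alike, are covered by the hypothesis on
  powers.\<close>

lemma lower_central_pow_mem:
  assumes N: "N \<lhd> G" and n: "2 \<le> n"
    and central: "\<And>x y. \<lbrakk>x \<in> carrier G; y \<in> carrier G\<rbrakk> \<Longrightarrow> commutator G (x [^] e) y \<in> N"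
    and pow: "\<And>i g. \<lbrakk>2 \<le> i; i \<le> e; g \<in> lower_central G (1 + (n - 1) * i)\<rbrakk>
      \<Longrightarrow> g [^] (e choose i) \<in> N"
    and g: "g \<in> lower_central G n"
  shows "g [^] e \<in> N"
proof -
  interpret filtered_group G "lower_central G" by (rule filtered_lower_central)
  have S: "subgroup N G" using N by (rule normal_imp_subgroup)
  interpret N: subgroup N G by (rule S)
  obtain d where d: "n = Suc (Suc d)" using n by (metis add_2_eq_Suc le_Suc_ex)
  let ?S = "{commutator G y x | y x. y \<in> lower_central G (Suc d) \<and> x \<in> carrier G}"
  have S_carrier: "?S \<subseteq> carrier G"
    using filtration_closed by auto
  have mult: "(u \<otimes> v) [^] e \<in> N"
    if uv: "u \<in> lower_central G n" "v \<in> lower_central G n" and "u [^] e \<in> N" "v [^] e \<in> N" for u v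
  proof -
    have carrier: "u \<in> carrier G" "v \<in> carrier G" using uv filtration_closed by blast+
    have "inv (v [^] e) \<otimes> inv (u [^] e) \<otimes> (u \<otimes> v) [^] e \<in> N"
    proof (rule power_mult_mem[OF uv S])
      fix i g assume i: "2 \<le> i" "i \<le> e" and "g \<in> lower_central G (n * i)"
      \<comment> \<open>Corrections for products lie at depth \<open>n * i\<close>, at least as deep
        as those for generators.\<close>
      moreover have "1 + (n - 1) * i \<le> n * i"
        using i by (simp add: d)
      ultimately show "g [^] (e choose i) \<in> N"
        using pow i lower_central_antimono by blast
    qed
    then have "u [^] e \<otimes> v [^] e \<otimes> (inv (v [^] e) \<otimes> inv (u [^] e) \<otimes> (u \<otimes> v) [^] e) \<in> N"
      using that by simp
    then show ?thesis using carrier by (simp add: group_word_simps)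
  qed
  have gen: "h [^] e \<in> N" if "h \<in> ?S" for h
  proof -
    from that obtain y x where h: "h = commutator G y x"
      and y: "y \<in> lower_central G (Suc d)" "y \<in> carrier G" and x: "x \<in> carrier G"
      using filtration_closed by auto
    have "commutator G (y [^] e) x \<otimes> inv (h [^] e) \<in> N"
      unfolding h by (rule commutator_power_mem[OF y(1) _ S, where j = 1])
        (use pow x in \<open>simp_all add: d\<close>)
    then have "inv (commutator G (y [^] e) x \<otimes> inv (h [^] e)) \<otimes> commutator G (y [^] e) x \<in> N"
      using central[OF y(2) x] by simp
    then show ?thesis
      using x y by (simp add: h group_word_simps)
  qed
  have "g \<in> generate G ?S"
    using g by (simp add: d comm_subgroup_eq)
  then show ?thesis
  proof (induction rule: generate.induct)
    case one
    then show ?case by simp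
  next
    case (incl h)
    then show ?case by (rule gen)
  next
    case (inv h)
    then have "h \<in> carrier G" using S_carrier by blast
    then show ?case using gen[OF inv] by (simp add: nat_pow_inv)
  next
    case (eng h1 h2)
    then show ?case by (intro mult) (simp_all add: d comm_subgroup_eq)
  qed
qed

lemma conj_nat_pow:
  assumes "x \<in> carrier G" "g \<in> carrier G"
  shows "inv g \<otimes> x [^] (n::nat) \<otimes> g = (inv g \<otimes> x \<otimes> g) [^] n"
proof (induction n)
  case (Suc n)
  have "(inv g \<otimes> x \<otimes> g) [^] Suc n = inv g \<otimes> x [^] n \<otimes> g \<otimes> (inv g \<otimes> x \<otimes> g)"
    by (simp add: Suc.IH)
  then show ?case using assms by (simp add: group_word_simps)
qed (simp add: assms)

lemma power_subgroup_normal: "power_subgroup G n \<lhd> G"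
  unfolding power_subgroup_def
proof (rule normal_generateI', goal_cases)
  case (2 s g)
  then obtain x where "x \<in> carrier G" "s = x [^] n" by blast
  then show ?case using 2 by (auto simp: conj_nat_pow intro!: generate.incl)
qed auto

lemma normal_generate_Un:
  assumes "M \<lhd> G" "N \<lhd> G"
  shows "generate G (M \<union> N) \<lhd> G"
proof (rule normal_generateI')
  show "M \<union> N \<subseteq> carrier G"
    using assms by (simp add: normal_imp_subgroup subgroup.subset)
qed (use assms in \<open>auto intro!: generate.incl intro: normal_conj_closed\<close>)

lemma commute_mod_normal:
  assumes N: "N \<lhd> G" and x: "x \<in> carrier G" "y \<in> carrier G"
    and c: "commutator G (inv x) (inv y) \<in> N"
  shows "(N #> x) \<otimes>\<^bsub>G Mod N\<^esub> (N #> y) = (N #> y) \<otimes>\<^bsub>G Mod N\<^esub> (N #> x)"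
proof -
  interpret N: normal N G by (rule N)
  have "x \<otimes> y = commutator G (inv x) (inv y) \<otimes> (y \<otimes> x)"
    using x by (simp add: commutator_def group_word_simps)
  then have "x \<otimes> y \<in> N #> (y \<otimes> x)"
    using c unfolding r_coset_def by auto
  then have "N #> (y \<otimes> x) = N #> (x \<otimes> y)"
    using x by (intro repr_independence N.subgroup_axioms) simp_all
  then show ?thesis using x by (simp add: N.rcos_sum)
qed

section \<open>Exponents of the lower central terms modulo \<open>N\<close>\<close>

context
  fixes p q k :: nat and N :: "'a set"
  assumes p: "Factorial_Ring.prime p" and q: "q = p ^ k"
    and N: "N \<lhd> G"
    and central: "\<And>x y. \<lbrakk>x \<in> carrier G; y \<in> carrier G\<rbrakk> \<Longrightarrow> commutator G (x [^] q) y \<in> N"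
    and nilpotent: "lower_central G (Suc (p\<^sup>2 - p)) \<subseteq> N"
begin

lemma pow_q_mem:
  assumes "p \<le> n" "g \<in> lower_central G n"
  shows "g [^] q \<in> N"
  using assms
proof (induction "Suc (p\<^sup>2 - p) - n" arbitrary: n g)
  case 0
  then have "g \<in> N" using nilpotent lower_central_antimono[of "Suc (p\<^sup>2 - p)" n] by auto
  then show ?case using N by (simp add: normal_imp_subgroup subgroup_nat_pow_closed)
next
  case (Suc r)
  have p2: "2 \<le> p" using p by (rule prime_ge_2_nat)
  have S: "subgroup N G" using N by (rule normal_imp_subgroup)
  show ?case
  proof (rule lower_central_pow_mem[OF N _ central _ Suc.prems(2)])
    show "2 \<le> n" using p2 Suc.prems(1) by simp
  next
    fix i h assume i: "2 \<le> i" and h: "h \<in> lower_central G (1 + (n - 1) * i)"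
    have h': "h \<in> carrier G" using h lower_central_subset_carrier by blast
    show "h [^] (q choose i) \<in> N"
    proof (cases "i < p")
      case True
      have "(n - 1) * 2 \<le> (n - 1) * i" using i by (intro mult_le_mono) simp_all
      then have "Suc n \<le> 1 + (n - 1) * i" using Suc.prems(1) p2 by linarith
      then have "h \<in> lower_central G (Suc n)" using h lower_central_antimono by blast
      then have "h [^] q \<in> N"
        using Suc.hyps(2) Suc.prems(1) by (intro Suc.hyps(1)[of "Suc n"]) simp_all
      moreover have "q dvd (q choose i)"
        using prime_power_dvd_choose[OF p, of i k] True i by (simp add: q)
      ultimately show ?thesis by (rule pow_mem_of_dvd[OF S h'])
    next
      case False
      \<comment> \<open>This is where the class bound is used: \<open>n \<ge> p\<close> and
        \<open>i \<ge> p\<close> give depth at least \<open>1 + (p - 1) * p\<close>, exactly the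
        index of the term assumed to lie in \<open>N\<close>.\<close>
      then have "(p - 1) * p \<le> (n - 1) * i" using Suc.prems(1) by (intro mult_le_mono) simp_all
      then have "Suc (p\<^sup>2 - p) \<le> 1 + (n - 1) * i"
        by (simp add: power2_eq_square diff_mult_distrib)
      then have "h \<in> N" using h nilpotent lower_central_antimono by blast
      then show ?thesis using S by (simp add: subgroup_nat_pow_closed)
    qed
  qed auto
qed

text \<open>Three ranges of \<open>i\<close>: below \<open>p\<close> the coefficient is divisible by
  \<open>p * q\<close>; below \<open>p\<^sup>2\<close> it is divisible by \<open>q\<close>, which
  suffices at depth \<open>i \<ge> p\<close>; beyond that \<open>h\<close> is already in
  \<open>N\<close>.\<close>

lemma choose_pow_mem:
  assumes i: "2 \<le> i" and h: "h \<in> lower_central G i" and pq: "h [^] (p * q) \<in> N"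
  shows "h [^] (p * q choose i) \<in> N"
proof -
  have S: "subgroup N G" using N by (rule normal_imp_subgroup)
  have h': "h \<in> carrier G" using h lower_central_subset_carrier by blast
  consider "i < p" | "p \<le> i" "i < p\<^sup>2" | "p\<^sup>2 \<le> i" by linarith
  then show ?thesis
  proof cases
    case 1
    then show ?thesis
      using prime_power_dvd_choose[OF p, of i "Suc k"] i
      by (intro pow_mem_of_dvd[OF S h' pq]) (simp add: q)
  next
    case 2
    then show ?thesis
      using prime_power_dvd_choose_Suc[OF p, of i k] i
      by (intro pow_mem_of_dvd[OF S h' pow_q_mem[OF _ h]]) (simp_all add: q)
  next
    case 3
    have "0 < p" using p by (simp add: prime_gt_0_nat)
    then have "0 < p\<^sup>2" by simp
    then have "Suc (p\<^sup>2 - p) \<le> i" using 3 \<open>0 < p\<close> by linarith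
    then have "h \<in> N" using h nilpotent lower_central_antimono by blast
    then show ?thesis using S by (simp add: subgroup_nat_pow_closed)
  qed
qed

text \<open>For \<open>n \<ge> p\<close> exponent \<open>q\<close> already suffices. Below
  \<open>p\<close>, each correction is deep enough both for the induction hypothesis at
  \<open>n + 1\<close> and for \<open>choose_pow_mem\<close>.\<close>

lemma pow_pq_mem:
  assumes "2 \<le> n" "g \<in> lower_central G n"
  shows "g [^] (p * q) \<in> N"
  using assms
proof (induction "p - n" arbitrary: n g)
  case 0
  then show ?case
    using lower_central_subset_carrier
    by (intro pow_mem_of_dvd[OF normal_imp_subgroup[OF N] _ pow_q_mem[of n]]) auto
next
  case (Suc r)
  show ?case
  proof (rule lower_central_pow_mem[OF N Suc.prems(1) _ _ Suc.prems(2)])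
    fix x y assume "x \<in> carrier G" "y \<in> carrier G"
    then show "commutator G (x [^] (p * q)) y \<in> N"
      using central[of "x [^] p" y] by (simp add: nat_pow_pow)
  next
    fix i h assume i: "2 \<le> i" and h: "h \<in> lower_central G (1 + (n - 1) * i)"
    have "(n - 1) * 2 \<le> (n - 1) * i" "1 * i \<le> (n - 1) * i"
      using i Suc.prems(1) by (intro mult_le_mono; simp)+
    then have "Suc n \<le> 1 + (n - 1) * i" "i \<le> 1 + (n - 1) * i" using Suc.prems(1) by linarith+
    then have h': "h \<in> lower_central G (Suc n)" "h \<in> lower_central G i"
      using h lower_central_antimono by blast+
    have "h [^] (p * q) \<in> N"
      using h'(1) Suc.hyps(2) Suc.prems(1) by (intro Suc.hyps(1)[of "Suc n"]) simp_all
    with i h'(2) show "h [^] (p * q choose i) \<in> N" by (rule choose_pow_mem)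
  qed
qed

text \<open>Hall-Petrescu at exponent \<open>q * p\<close> puts the corresponding word in
  \<open>N\<close>. As \<open>q\<close>-th powers are central modulo \<open>N\<close>, that word is
  congruent to the \<open>p\<close>-th power of the word at exponent \<open>q\<close>.\<close>

lemma hopf_word_pow_mem:
  assumes x: "x \<in> carrier G" and y: "y \<in> carrier G"
  shows "(inv (y [^] q) \<otimes> inv (x [^] q) \<otimes> (x \<otimes> y) [^] q) [^] p \<in> N"
proof -
  interpret filtered_group G "lower_central G" by (rule filtered_lower_central)
  interpret N: normal N G by (rule N)
  interpret Q: group "G Mod N" by (rule N.factorgroup_is_group)
  let ?c = "\<lambda>z. N #> z" and ?z = "\<lambda>e. inv (y [^] e) \<otimes> inv (x [^] e) \<otimes> (x \<otimes> y) [^] (e::nat)"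
  have z: "?z (q * p) \<in> N"
  proof (rule power_mult_mem[of _ 1])
    fix i g assume "2 \<le> i" "g \<in> lower_central G (1 * i)"
    then show "g [^] (q * p choose i) \<in> N"
      using choose_pow_mem[OF _ _ pow_pq_mem, of i g i] by (simp add: mult.commute)
  qed (use x y in \<open>simp_all add: N.subgroup_axioms\<close>)
  have comm: "?c (inv (u [^] q)) \<otimes>\<^bsub>G Mod N\<^esub> ?c v = ?c v \<otimes>\<^bsub>G Mod N\<^esub> ?c (inv (u [^] q))"
    if "u \<in> carrier G" "v \<in> carrier G" for u v
    using that central[of u "inv v"] by (intro commute_mod_normal N) simp_all
  have hom: "?c (u \<otimes> v) = ?c u \<otimes>\<^bsub>G Mod N\<^esub> ?c v" if "u \<in> carrier G" "v \<in> carrier G" for u v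
    using that by (simp add: N.rcos_sum)
  have carrier: "?c u \<in> carrier (G Mod N)" if "u \<in> carrier G" for u
    using that by (auto simp: carrier_FactGroup)
  have "?c (?z q [^] p) = ?c (?z q) [^]\<^bsub>G Mod N\<^esub> p"
    using x y by (simp add: N.FactGroup_pow)
  also have "\<dots> = (?c (inv (y [^] q)) \<otimes>\<^bsub>G Mod N\<^esub> (?c (inv (x [^] q)) \<otimes>\<^bsub>G Mod N\<^esub>
      ?c ((x \<otimes> y) [^] q))) [^]\<^bsub>G Mod N\<^esub> p"
    using x y by (simp add: m_assoc hom[symmetric] del: mult_FactGroup)
  also have "\<dots> = ?c (inv (y [^] q)) [^]\<^bsub>G Mod N\<^esub> p \<otimes>\<^bsub>G Mod N\<^esub> (?c (inv (x [^] q)) \<otimes>\<^bsub>G Mod N\<^esub>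
      ?c ((x \<otimes> y) [^] q)) [^]\<^bsub>G Mod N\<^esub> p"
    using x y comm[of y "inv (x [^] q) \<otimes> (x \<otimes> y) [^] q"]
    by (intro Q.pow_mult_distrib Q.m_closed carrier) (simp_all add: hom del: mult_FactGroup)
  also have "\<dots> = ?c (inv (y [^] q)) [^]\<^bsub>G Mod N\<^esub> p \<otimes>\<^bsub>G Mod N\<^esub> (?c (inv (x [^] q)) [^]\<^bsub>G Mod N\<^esub> p
      \<otimes>\<^bsub>G Mod N\<^esub> ?c ((x \<otimes> y) [^] q) [^]\<^bsub>G Mod N\<^esub> p)"
    using x y comm[of x "(x \<otimes> y) [^] q"]
    by (subst Q.pow_mult_distrib[of "?c (inv (x [^] q))"]) (simp_all add: carrier del: mult_FactGroup)
  also have "\<dots> = ?c (?z (q * p))"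
    using x y by (simp add: N.FactGroup_pow hom[symmetric] m_assoc nat_pow_inv nat_pow_pow
        del: mult_FactGroup)
  also have "\<dots> = N" using z by (simp add: N.rcos_const)
  finally show ?thesis
    by (rule coset_join1) (use x y N.subgroup_axioms in simp_all)
qed

end

end


section \<open>The free group of rank two\<close>

definition flip :: "letter \<Rightarrow> letter" where
  "flip x = (fst x, \<not> snd x)"

lemma cancels_flip: "cancels x y \<longleftrightarrow> y = flip x"
  by (cases x; cases y) (auto simp: cancels_def flip_def)

lemma flip_flip [simp]: "flip (flip x) = x"
  by (simp add: flip_def)

lemma reduced_ConsD: "reduced (x # w) \<Longrightarrow> reduced w"
  by (cases w) auto

lemma reduced_push: "reduced w \<Longrightarrow> reduced (push x w)"
  by (cases w) (auto dest: reduced_ConsD)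

lemma push_eq_Cons: "reduced (x # w) \<Longrightarrow> push x w = x # w"
  by (cases w) auto

text \<open>If \<open>push x\<close> deletes a leading \<open>flip x\<close>, reducedness of
  \<open>w\<close> ensures that the second push restores it without a further cancellation.\<close>

lemma push_flip_push: "reduced w \<Longrightarrow> push (flip x) (push x w) = w"
  by (cases w) (auto simp: cancels_flip push_eq_Cons)

lemma reduced_foldr_push: "reduced w \<Longrightarrow> reduced (foldr push u w)"
  by (induction u) (auto intro: reduced_push)

lemma reduced_reduce: "reduced (reduce u)"
  by (simp add: reduce_def reduced_foldr_push)

lemma reduce_reduced: "reduced w \<Longrightarrow> reduce w = w"
proof (induction w)
  case (Cons x w)
  then have "reduce w = w" using reduced_ConsD by blast
  then show ?case using push_eq_Cons[OF Cons.prems] by (simp add: reduce_def)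
qed (simp add: reduce_def)

lemma foldr_push_push:
  assumes "reduced w"
  shows "foldr push (push x u) w = push x (foldr push u w)"
proof (cases u)
  case (Cons y v)
  have "push x (push (flip x) (foldr push v w)) = foldr push v w"
    using push_flip_push[OF reduced_foldr_push[OF assms], of "flip x" v] by simp
  then show ?thesis by (simp add: Cons cancels_flip)
qed simp

text \<open>Words act on reduced words by successive pushes, and free reduction of the acting word
  preserves this action. Associativity in \<open>free2\<close> follows.\<close>

lemma foldr_push_foldr:
  "reduced w \<Longrightarrow> foldr push (foldr push u v) w = foldr push u (foldr push v w)"
  by (induction u) (simp_all add: foldr_push_push)

lemma foldr_push_reduce: "reduced w \<Longrightarrow> foldr push (reduce u) w = foldr push u w"
  by (simp add: reduce_def foldr_push_foldr)

lemma reduce_append: "reduce (u @ v) = foldr push u (reduce v)"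
  by (simp add: reduce_def)

lemma reduce_inverse: "reduced u \<Longrightarrow> reduce (rev (map flip u) @ u) = []"
proof (induction u)
  case Nil
  then show ?case by (simp add: reduce_def)
next
  case (Cons x u)
  then have u: "reduced u" "push (flip x) (x # u) = u"
    using reduced_ConsD by (auto simp: cancels_flip)
  have "reduce (rev (map flip (x # u)) @ x # u) = foldr push (rev (map flip u)) (push (flip x) (x # u))"
    using reduce_reduced[OF Cons.prems] reduce_append[of "rev (map flip u) @ [flip x]" "x # u"]
    by (simp del: push.simps)
  also have "\<dots> = reduce (rev (map flip u) @ u)"
    using u by (simp add: reduce_append reduce_reduced del: push.simps)
  also have "\<dots> = []"
    using Cons.IH u by simp
  finally show ?case .
qed

lemma group_free2: "group free2"
proof (rule groupI)
  fix u assume "u \<in> carrier free2"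
  \<comment> \<open>The inverse is the reversed word with flipped letters; applying
    \<open>reduce\<close> puts it in the carrier at once.\<close>
  then have "reduce (reduce (rev (map flip u)) @ u) = []"
    using reduce_inverse[of u]
    by (simp add: free2_def reduce_append foldr_push_reduce reduced_reduce)
  then show "\<exists>v\<in>carrier free2. v \<otimes>\<^bsub>free2\<^esub> u = \<one>\<^bsub>free2\<^esub>"
    by (intro bexI[of _ "reduce (rev (map flip u))"]) (simp_all add: free2_def reduced_reduce)
qed (auto simp: free2_def reduced_reduce reduce_reduced reduce_append foldr_push_foldr
    reduced_foldr_push)

lemma gen_in_free2: "gen_a \<in> carrier free2" "gen_b \<in> carrier free2"
  by (simp_all add: free2_def gen_a_def gen_b_def)


section \<open>The Schur multiplier\<close>

interpretation F: group free2
  by (rule group_free2)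

theorem theorem4:
  fixes p q :: nat
  assumes "Factorial_Ring.prime p" and "\<exists>k\<ge>1. q = p ^ k"
  shows "e_qc q (p^2 - p - 1) dvd p"
proof -
  obtain k where q: "q = p ^ k" using assms(2) by blast
  have "2 \<le> p" using assms(1) by (rule prime_ge_2_nat)
  then have "2 * p \<le> p\<^sup>2" by (simp add: power2_eq_square)
  define c where "c = p^2 - p - 1"
  \<comment> \<open>Since \<open>p\<^sup>2 - p \<ge> p\<close>, the truncated subtraction in
    \<open>c\<close> loses nothing.\<close>
  have c: "p\<^sup>2 - p = Suc c"
    using \<open>2 \<le> p\<close> \<open>2 * p \<le> p\<^sup>2\<close> by (simp add: c_def)
  let ?R = "burnside_rel q c" and ?\<gamma> = "lower_central free2"
  let ?N = "comm_subgroup free2 (carrier free2) ?R"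
  let ?K = "free2\<lparr>carrier := ?R \<inter> ?\<gamma> 2\<rparr>"

  have R: "?R \<lhd> free2"
    unfolding burnside_rel_def
    by (intro F.normal_generate_Un F.power_subgroup_normal F.lower_central_normal)
  interpret R: subgroup ?R free2 using R by (rule normal_imp_subgroup)
  interpret L: subgroup "?\<gamma> 2" free2 by (rule F.lower_central_subgroup)
  have N_eq: "?N = comm_subgroup free2 ?R (carrier free2)"
    by (rule F.comm_subgroup_carrier_commute[OF R.subset])
  have N: "?N \<lhd> free2"
    unfolding N_eq by (rule F.comm_subgroup_carrier_right_normal[OF R.subset])
  have N_R: "?N \<subseteq> ?R"
    unfolding comm_subgroup_eq
    by (rule F.generate_subgroup_incl[OF _ R.subgroup_axioms])
      (auto simp: F.normal_commutator_right[OF R])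
  have "?N \<subseteq> ?\<gamma> 2"
    unfolding comm_subgroup_eq numeral_2_eq_2 lower_central.simps
    by (rule F.mono_generate) (use R.subset in auto)
  with N_R have "?N \<lhd> ?K"
    by (intro F.normal_restrict_supergroup N F.subgroups_Inter_pair
        R.subgroup_axioms L.subgroup_axioms) auto
  then interpret N: normal ?N ?K .
  interpret M: group "schur_mult q c"
    unfolding schur_mult_def by (rule N.factorgroup_is_group)

  have gens: "gen_a \<in> carrier free2" "gen_b \<in> carrier free2"
    by (rule gen_in_free2)+
  have pow_R: "x [^]\<^bsub>free2\<^esub> q \<in> ?R" if "x \<in> carrier free2" for x
    using that unfolding burnside_rel_def power_subgroup_def by (auto intro!: generate.incl)
  have central: "commutator free2 (x [^]\<^bsub>free2\<^esub> q) y \<in> ?N"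
    if "x \<in> carrier free2" "y \<in> carrier free2" for x y
    unfolding N_eq unfolding comm_subgroup_eq using that pow_R by (auto intro!: generate.incl)
  \<comment> \<open>Class at most \<open>c\<close> puts term \<open>c + 1\<close> inside
    \<open>R\<close>, so term \<open>c + 2\<close> lies in \<open>[R, F] = [F, R]\<close>.\<close>
  have nilpotent: "?\<gamma> (Suc (p\<^sup>2 - p)) \<subseteq> ?N"
    unfolding N_eq c lower_central.simps unfolding comm_subgroup_eq
    by (rule F.mono_generate) (auto simp: burnside_rel_def intro!: generate.incl)
  have pow_N: "wqc q [^]\<^bsub>free2\<^esub> p \<in> ?N"
    unfolding wqc_def
    by (rule F.hopf_word_pow_mem[OF assms(1) q N central nilpotent gens])

  interpret filtered_group free2 ?\<gamma> by (rule F.filtered_lower_central)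
  \<comment> \<open>Hall-Petrescu again, now only for depth: every correction has index
    \<open>i \<ge> 2\<close> and so lies in the derived subgroup.\<close>
  have "wqc q \<in> ?\<gamma> 2"
    unfolding wqc_def
  proof (rule power_mult_mem[of _ 1])
    fix i g assume "2 \<le> i" "g \<in> ?\<gamma> (1 * i)"
    then have "g \<in> ?\<gamma> 2" using F.lower_central_antimono by auto
    then show "g [^]\<^bsub>free2\<^esub> (q choose i) \<in> ?\<gamma> 2"
      by (rule F.subgroup_nat_pow_closed[OF L.subgroup_axioms])
  qed (use gens L.subgroup_axioms in simp_all)
  moreover have "wqc q \<in> ?R"
    unfolding wqc_def by (intro R.m_closed R.m_inv_closed pow_R F.m_closed gens)
  ultimately have w: "wqc q \<in> carrier ?K" by simp
  \<comment> \<open>Cosets of \<open>[F, R]\<close> are the same sets in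
    \<open>R \<inter> F'\<close> and in \<open>F\<close>, so the power computed in \<open>F\<close>
    can be read in the multiplier.\<close>
  have coset: "?N #>\<^bsub>?K\<^esub> u = ?N #>\<^bsub>free2\<^esub> u" for u
    by (simp add: r_coset_def)
  have "?N #>\<^bsub>free2\<^esub> wqc q \<in> carrier (schur_mult q c)"
    using w by (auto simp: schur_mult_def carrier_FactGroup coset)
  moreover have "(?N #>\<^bsub>free2\<^esub> wqc q) [^]\<^bsub>schur_mult q c\<^esub> p = \<one>\<^bsub>schur_mult q c\<^esub>"
    using N.FactGroup_pow[OF w, of p] F.coset_join2[OF _ normal_imp_subgroup[OF N] pow_N] pow_N
      subgroup.mem_carrier[OF normal_imp_subgroup[OF N]]
    by (simp add: schur_mult_def coset F.nat_pow_consistent[symmetric])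
  ultimately show ?thesis
    unfolding e_qc_def c_def[symmetric] by (simp add: M.pow_eq_id)
qed

end
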